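(* Let $G$ be a finite abstract simplicial complex with $n$ sets, and let $K$ be its counting matrix, i.e. the $n\times n$ matrix with entries $K(x,y)=|W^-(x)\cap W^-(y)|$ for $x,y\in G$. Then $K$ is invertible and for all $x,y\in G$, $$K^{-1}(x,y)=\omega(x)\,\omega(y)\,|W^+(x)\cap W^+(y)|.$$
   Context: A finite abstract simplicial complex $G$ is a finite set of non-empty finite sets that is closed under taking non-empty subsets (the empty set is not an element of $G$). For $x\in G$, the core of $x$ is $W^-(x)=\{u\in G : u\subseteq x\}$ and the star of $x$ is $W^+(x)=\{u\in G : x\subseteq u\}$. Put $\omega(x)=(-1)^{|x|}$. The counting matrix $K$ of $G$ has its rows and columns indexed by the elements of $G$ (in some fixed order, the same for rows and columns), with $K(x,y)=|W^-(x)\cap W^-(y)|=2^{|x\cap y|}-1$; $K^{-1}$ is indexed in the same way. *)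

theory Defs
  imports "Jordan_Normal_Form.Gauss_Jordan_Elimination"
begin

definition finite_abstract_simplicial_complex :: "'a set set \<Rightarrow> bool" where
  "finite_abstract_simplicial_complex G \<longleftrightarrow>
     finite G \<and>
     (\<forall>x\<in>G. finite x \<and> x \<noteq> {}) \<and>
     (\<forall>x\<in>G. \<forall>u. u \<noteq> {} \<and> u \<subseteq> x \<longrightarrow> u \<in> G)"

definition core_of :: "'a set set \<Rightarrow> 'a set \<Rightarrow> 'a set set" where
  "core_of G x = {u \<in> G. u \<subseteq> x}"

definition star_of :: "'a set set \<Rightarrow> 'a set \<Rightarrow> 'a set set" where
  "star_of G x = {u \<in> G. x \<subseteq> u}"

definition omega :: "'a set \<Rightarrow> real" where
  "omega x = (-1) ^ card x"

text \<open>The function \<open>e\<close> fixes the order of the rows and columns: it is meant to be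
  a bijection from \<open>{..<card G}\<close> onto \<open>G\<close>, and row (column) \<open>i\<close> belongs to the
  set \<open>e i\<close>.\<close>

definition counting_matrix :: "'a set set \<Rightarrow> (nat \<Rightarrow> 'a set) \<Rightarrow> real mat" where
  "counting_matrix G e =
     mat (card G) (card G) (\<lambda>(i, j). real (card (core_of G (e i) \<inter> core_of G (e j))))"

end

theory Submission
  imports Defs "Jordan_Normal_Form.Determinant"
begin

text \<open>
  Write \<open>[u \<subseteq> x]\<close> for the truth value as a number. Counting intersections gives
  \<open>K(x,y) = \<Sum>u\<in>G. [u \<subseteq> x] [u \<subseteq> y]\<close>, that is, \<open>K = Z\<^sup>T Z\<close> where \<open>Z\<close> is the zeta
  matrix of the inclusion order on the complex. Every interval of that order is Boolean: since
  the complex is closed under non-empty subsets, it contains each set between two of its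
  members. So the Moebius function of the order is \<open>\<omega>(x) \<omega>(y) [x \<subseteq> y]\<close>, and the matrix in the
  theorem is \<open>Z\<^sup>-\<^sup>1 (Z\<^sup>-\<^sup>1)\<^sup>T\<close>.

  The proof multiplies this out. In \<open>\<Sum>y. K(x,y) L(y,z)\<close> both counts are expanded as sums, over
  \<open>u \<subseteq> x, y\<close> and over \<open>v \<supseteq> y, z\<close>. Moebius inversion, in the form that \<open>\<omega>\<close> sums to zero over any
  interval with distinct end points (\<open>sum_omega_interval\<close>), is applied twice: summing over
  \<open>y\<close> with \<open>u \<subseteq> y \<subseteq> v\<close> forces \<open>v = u\<close>, and the remaining sum over \<open>u\<close> with \<open>z \<subseteq> u \<subseteq> x\<close>
  forces \<open>z = x\<close>. This gives \<open>K L = 1\<close>, and for square matrices a one-sided inverse is the inverse.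
\<close>

text \<open>When \<open>u \<noteq> v\<close>, toggling a fixed point of \<open>v - u\<close> pairs the even with the odd members of the
  interval, so that they cancel.\<close>

lemma sum_omega_Boolean_interval:
  assumes "finite v" "u \<subseteq> v"
  shows "(\<Sum>y | u \<subseteq> y \<and> y \<subseteq> v. omega y) = (if u = v then omega u else 0)"
proof (cases "u = v")
  case True
  then have "{y. u \<subseteq> y \<and> y \<subseteq> v} = {u}" by blast
  with True show ?thesis by simp
next
  case False
  with assms have "u \<subset> v" by blast
  with assms(1) have "card {y. u \<subseteq> y \<and> y \<subseteq> v \<and> even (card y)} = card {y. u \<subseteq> y \<and> y \<subseteq> v \<and> odd (card y)}"
    using card_subsupersets_even_odd[of v u] by (simp add: conj_ac)
  with assms(1) False show ?thesis
    unfolding omega_def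
    using sum_alternating_cancels[of "{y. u \<subseteq> y \<and> y \<subseteq> v}" card, where ?'b = real]
    by (simp add: conj_ac)
qed

text \<open>Inside the complex the interval is still the full Boolean one: each \<open>y\<close> in it contains the
  non-empty \<open>u\<close> and is a subset of \<open>v\<close>, hence a member. The indicator factors match the sums
  that arise from counting cores and stars.\<close>

lemma sum_omega_interval:
  assumes "finite_abstract_simplicial_complex G" "u \<in> G" "v \<in> G"
  shows "(\<Sum>y\<in>G. of_bool (u \<subseteq> y) * of_bool (y \<subseteq> v) * omega y) = of_bool (u = v) * omega u"
proof (cases "u \<subseteq> v")
  case True
  have fin: "finite G" and finv: "finite v" and ne: "u \<noteq> {}"
    and closed: "\<And>y. y \<noteq> {} \<Longrightarrow> y \<subseteq> v \<Longrightarrow> y \<in> G"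
    using assms unfolding finite_abstract_simplicial_complex_def by blast+
  have "(\<Sum>y\<in>G. of_bool (u \<subseteq> y) * of_bool (y \<subseteq> v) * omega y)
      = (\<Sum>y | u \<subseteq> y \<and> y \<subseteq> v. omega y)"
    using fin ne closed by (intro sum.mono_neutral_cong_right) auto
  with sum_omega_Boolean_interval[OF finv True] show ?thesis by simp
next
  case False
  then have "of_bool (u \<subseteq> y) * of_bool (y \<subseteq> v) * omega y = 0" for y by auto
  moreover from False have "u \<noteq> v" by blast
  ultimately show ?thesis by (simp only: sum.neutral_const) simp
qed

lemma card_core_Int_core:
  assumes "finite G"
  shows "real (card (core_of G x \<inter> core_of G y)) = (\<Sum>u\<in>G. of_bool (u \<subseteq> x) * of_bool (u \<subseteq> y))"
proof -
  have "core_of G x \<inter> core_of G y = G \<inter> {u. u \<subseteq> x \<and> u \<subseteq> y}"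
    by (auto simp: core_of_def)
  with assms show ?thesis by (simp flip: of_bool_conj)
qed

lemma card_star_Int_star:
  assumes "finite G"
  shows "real (card (star_of G x \<inter> star_of G y)) = (\<Sum>v\<in>G. of_bool (x \<subseteq> v) * of_bool (y \<subseteq> v))"
proof -
  have "star_of G x \<inter> star_of G y = G \<inter> {v. x \<subseteq> v \<and> y \<subseteq> v}"
    by (auto simp: star_of_def)
  with assms show ?thesis by (simp flip: of_bool_conj)
qed

text \<open>The identity \<open>K L = 1\<close>, entry by entry and free of any ordering of the complex.\<close>

lemma sum_core_star_orthogonal:
  assumes G: "finite_abstract_simplicial_complex G" and x: "x \<in> G" and z: "z \<in> G"
  shows "(\<Sum>y\<in>G. real (card (core_of G x \<inter> core_of G y))
      * (omega y * omega z * real (card (star_of G y \<inter> star_of G z)))) = of_bool (x = z)"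
    (is "?lhs = _")
proof -
  have fin: "finite G" using G unfolding finite_abstract_simplicial_complex_def by simp
  have "?lhs = (\<Sum>y\<in>G. \<Sum>u\<in>G. \<Sum>v\<in>G. omega z * of_bool (u \<subseteq> x) * of_bool (z \<subseteq> v)
      * (of_bool (u \<subseteq> y) * of_bool (y \<subseteq> v) * omega y))"
    unfolding card_core_Int_core[OF fin] card_star_Int_star[OF fin]
    by (intro sum.cong refl, subst sum_distrib_left, subst sum_product, intro sum.cong refl)
      (simp only: mult_ac)
  also have "\<dots> = (\<Sum>u\<in>G. \<Sum>v\<in>G. \<Sum>y\<in>G. omega z * of_bool (u \<subseteq> x) * of_bool (z \<subseteq> v)
      * (of_bool (u \<subseteq> y) * of_bool (y \<subseteq> v) * omega y))"
    by (rule trans[OF sum.swap], rule sum.cong[OF refl], rule sum.swap)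
  also have "\<dots> = (\<Sum>u\<in>G. \<Sum>v\<in>G. omega z * of_bool (u \<subseteq> x) * of_bool (z \<subseteq> v)
      * (of_bool (u = v) * omega u))"
    by (intro sum.cong refl, simp only: sum_distrib_left[symmetric] sum_omega_interval[OF G])
  also have "\<dots> = (\<Sum>u\<in>G. \<Sum>v\<in>G. if u = v then omega z * (of_bool (z \<subseteq> u) * of_bool (u \<subseteq> x) * omega u) else 0)"
    by (intro sum.cong refl) auto
  also have "\<dots> = (\<Sum>u\<in>G. omega z * (of_bool (z \<subseteq> u) * of_bool (u \<subseteq> x) * omega u))"
    using fin by simp
  also have "\<dots> = omega z * (of_bool (z = x) * omega z)"
    by (simp only: sum_distrib_left[symmetric] sum_omega_interval[OF G z x])
  also have "\<dots> = of_bool (x = z)"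
    by (cases "even (card z)") (auto simp: omega_def)
  finally show ?thesis .
qed

text \<open>The inversion algorithm returns some inverse whenever there is one, and inverses are
  unique.\<close>

lemma mat_inverse_eq_SomeI:
  fixes A B :: "'a :: field mat"
  assumes A: "A \<in> carrier_mat n n" and B: "B \<in> carrier_mat n n" and AB: "A * B = 1\<^sub>m n"
  shows "mat_inverse A = Some B"
proof -
  have BA: "B * A = 1\<^sub>m n" using mat_mult_left_right_inverse[OF A B AB] .
  have "A \<in> Units (ring_mat TYPE('a) n ())"
    using A B AB BA by (auto simp: Units_def ring_mat_simps)
  then obtain C where C: "mat_inverse A = Some C"
    using mat_inverse(1)[OF A, where b = "()"] by (cases "mat_inverse A") auto
  then have "C * A = 1\<^sub>m n" "C \<in> carrier_mat n n"
    using mat_inverse(2)[OF A C] by auto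
  then have "C = C * (A * B)" using AB by simp
  also have "\<dots> = C * A * B"
    using \<open>C \<in> carrier_mat n n\<close> A B by simp
  also have "\<dots> = B" using \<open>C * A = 1\<^sub>m n\<close> B by simp
  finally show ?thesis using C by simp
qed

theorem theorem2:
  fixes G :: "'a set set" and n :: nat and e :: "nat \<Rightarrow> 'a set"
  assumes "finite_abstract_simplicial_complex G"
    and "card G = n"
    and "bij_betw e {..<n} G"
  shows "invertible_mat (counting_matrix G e) \<and>
    (\<exists>L. mat_inverse (counting_matrix G e) = Some L \<and>
       (\<forall>i<n. \<forall>j<n.
          L $$ (i, j) = omega (e i) * omega (e j)
            * real (card (star_of G (e i) \<inter> star_of G (e j)))))"
proof -
  let ?K = "counting_matrix G e"
  define L where "L = mat n n (\<lambda>(i, j). omega (e i) * omega (e j)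
      * real (card (star_of G (e i) \<inter> star_of G (e j))))"
  have K: "?K \<in> carrier_mat n n" using assms(2) by (simp add: counting_matrix_def)
  have L: "L \<in> carrier_mat n n" by (simp add: L_def)
  have e_mem: "e i \<in> G" if "i < n" for i
    using assms(3) that by (auto simp: bij_betw_def)
  have e_eq: "e i = e j \<longleftrightarrow> i = j" if "i < n" "j < n" for i j
    using assms(3) that by (auto simp: bij_betw_def inj_on_def)
  have KL: "?K * L = 1\<^sub>m n"
  proof (rule eq_matI)
    fix i j assume "i < dim_row (1\<^sub>m n :: real mat)" "j < dim_col (1\<^sub>m n :: real mat)"
    then have ij: "i < n" "j < n" by auto
    have "(?K * L) $$ (i, j) = (\<Sum>k\<in>{..<n}. real (card (core_of G (e i) \<inter> core_of G (e k)))
        * (omega (e k) * omega (e j) * real (card (star_of G (e k) \<inter> star_of G (e j)))))"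
      using ij assms(2)
      by (simp add: counting_matrix_def L_def scalar_prod_def atLeast0LessThan)
    also have "\<dots> = (\<Sum>y\<in>G. real (card (core_of G (e i) \<inter> core_of G y))
        * (omega y * omega (e j) * real (card (star_of G y \<inter> star_of G (e j)))))"
      by (rule sum.reindex_bij_betw[OF assms(3)])
    also have "\<dots> = of_bool (e i = e j)"
      using ij by (intro sum_core_star_orthogonal[OF assms(1)] e_mem)
    also have "\<dots> = 1\<^sub>m n $$ (i, j)" using ij e_eq by simp
    finally show "(?K * L) $$ (i, j) = 1\<^sub>m n $$ (i, j)" .
  qed (use K L in auto)
  have "invertible_mat ?K"
    using K L KL mat_mult_left_right_inverse[OF K L KL]
    by (auto simp: invertible_mat_def inverts_mat_def)
  moreover have "mat_inverse ?K = Some L"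
    using K L KL by (rule mat_inverse_eq_SomeI)
  moreover have "\<forall>i<n. \<forall>j<n. L $$ (i, j) = omega (e i) * omega (e j)
      * real (card (star_of G (e i) \<inter> star_of G (e j)))"
    by (simp add: L_def)
  ultimately show ?thesis by blast
qed

end
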